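(* Let $k\ge2$ and $\Lambda\in P^+_{cl,k}$. For any $\Lambda'\in P^+_{cl,k}(\Lambda)$, there exists a path from $\Lambda$ to $\Lambda'$ in the undirected graph $C(\Lambda)$. In particular, $C(\Lambda)$ is a finite connected graph.
   Context: Fix an integer $\ell\ge1$, $e=\ell+1$, $I=\{0,1,\dots,\ell\}$; indices of the symbols $\Lambda_i$ are read modulo $e$. $\Lambda_0,\dots,\Lambda_\ell$ are the fundamental weights of type $A^{(1)}_\ell$ (for the present statement, free symbols), and $P^+_{cl,k}=\{\sum_{i\in I}m_i\Lambda_i\mid m_i\in\mathbb Z_{\ge0},\ \sum_i m_i=k\}$. For $\Lambda\in P^+_{cl,k}$, $P^+_{cl,k}(\Lambda)=\{\Lambda'\in P^+_{cl,k}\mid\mathrm{ev}(\Lambda')\equiv\mathrm{ev}(\Lambda)\pmod e\}$ where $\mathrm{ev}(\sum m_i\Lambda_i)=\sum_{i=1}^\ell i\,m_i$. If $\Lambda'=\Lambda_i+\Lambda_j+\tilde\Lambda\in P^+_{cl,k}(\Lambda)$ with $i,j\in I$, $\tilde\Lambda\in P^+_{cl,k-2}$, put $\Lambda'_{i,j}=\Lambda_{i-1}+\Lambda_{j+1}+\tilde\Lambda$ (again an element of $P^+_{cl,k}(\Lambda)$). $C(\Lambda)$ is the undirected graph with vertex set $P^+_{cl,k}(\Lambda)$ in which there is an edge between $\Lambda'$ and $\Lambda''$ if $\Lambda''=\Lambda'_{i,j}$ for some $i,j\in I$ with $j\not\equiv i-1\pmod e$. *)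

theory Defs
  imports
    "HOL-Library.Multiset"
    "HOL-Number_Theory.Cong"
    "Graph_Theory.Graph_Theory"
begin

text \<open>
  The fundamental weights are free symbols, so a sum of \<open>m\<^sub>i \<Lambda>\<^sub>i\<close> with natural number
  coefficients is encoded as the multiset over \<open>I\<close> in which \<open>i\<close> has multiplicity \<open>m\<^sub>i\<close>.
  Indices are integers so that \<open>i - 1\<close> is available before reduction modulo \<open>e = l + 1\<close>.
\<close>

definition index_set :: "nat \<Rightarrow> int set" where
  "index_set l = {0..int l}"

definition fund :: "nat \<Rightarrow> int \<Rightarrow> int multiset" where
  "fund l i = {# i mod (int l + 1) #}"

definition Pcl :: "nat \<Rightarrow> nat \<Rightarrow> int multiset set" where
  "Pcl l k = {L. set_mset L \<subseteq> index_set l \<and> (\<Sum>i\<in>index_set l. count L i) = k}"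

definition ev :: "nat \<Rightarrow> int multiset \<Rightarrow> int" where
  "ev l L = (\<Sum>i\<in>{1..int l}. i * int (count L i))"

definition Pcl_class :: "nat \<Rightarrow> nat \<Rightarrow> int multiset \<Rightarrow> int multiset set" where
  "Pcl_class l k L = {L' \<in> Pcl l k. [ev l L' = ev l L] (mod (int l + 1))}"

text \<open>
  \<open>weight_move l k L' L''\<close> says that \<open>L''\<close> is \<open>L'\<^bsub>i,j\<^esub>\<close> for some \<open>i, j \<in> I\<close> with
  \<open>j\<close> not congruent to \<open>i - 1\<close>. The witness \<open>T\<close> (the remaining summand of \<open>L'\<close>) is determined
  by \<open>L'\<close>, \<open>i\<close>, \<open>j\<close>. For \<open>k < 2\<close> the subtraction \<open>k - 2\<close> truncates; only \<open>k \<ge> 2\<close> is meant.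
\<close>

definition weight_move :: "nat \<Rightarrow> nat \<Rightarrow> int multiset \<Rightarrow> int multiset \<Rightarrow> bool" where
  "weight_move l k L' L'' \<longleftrightarrow>
     (\<exists>i\<in>index_set l. \<exists>j\<in>index_set l. \<exists>T\<in>Pcl l (k - 2).
        \<not> [j = i - 1] (mod (int l + 1)) \<and>
        L' = fund l i + fund l j + T \<and>
        L'' = fund l (i - 1) + fund l (j + 1) + T)"

text \<open>
  An undirected graph is represented as a digraph with symmetric arc relation, as in the
  library locale \<open>pair_graph\<close>; this is the reason for the symmetric closure.
\<close>

definition C_graph :: "nat \<Rightarrow> nat \<Rightarrow> int multiset \<Rightarrow> int multiset pair_pre_digraph" where
  "C_graph l k L =
     \<lparr> pverts = Pcl_class l k L,
       parcs = {(L1, L2). L1 \<in> Pcl_class l k L \<and> L2 \<in> Pcl_class l k L \<and>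
                          (weight_move l k L1 L2 \<or> weight_move l k L2 L1)} \<rparr>"

end

theory Submission
  imports Defs
begin

text \<open>
  A move with \<open>j \<equiv> i - 1\<close> would leave the weight unchanged, so up to reachability the side
  condition on moves can be ignored. Iterating the move that replaces \<open>\<Lambda>\<^sub>a + \<Lambda>\<^sub>b\<close> by
  \<open>\<Lambda>\<^bsub>a-1\<^esub> + \<Lambda>\<^bsub>b+1\<^esub>\<close> until the first index is \<open>0\<close> gives \<open>\<Lambda>\<^sub>0 + \<Lambda>\<^bsub>a+b\<^esub>\<close>. Collecting
  all indices into one in this way, every vertex reaches \<open>(k - 1) \<Lambda>\<^sub>0 + \<Lambda>\<^sub>r\<close>, where \<open>r\<close> is the
  common residue of \<open>ev\<close> on the class.
\<close>

lemma finite_index_set [simp]: "finite (index_set l)"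
  by (simp add: index_set_def)

lemma Pcl_iff: "L \<in> Pcl l k \<longleftrightarrow> set_mset L \<subseteq> index_set l \<and> size L = k"
proof -
  have "(\<Sum>i\<in>index_set l. count L i) = size L" if "set_mset L \<subseteq> index_set l"
    unfolding size_multiset_overloaded_eq using that
    by (intro sum.mono_neutral_right) (auto simp: not_in_iff)
  then show ?thesis
    by (auto simp: Pcl_def)
qed

lemma finite_Pcl: "finite (Pcl l k)"
proof (rule finite_subset)
  show "Pcl l k \<subseteq> mset ` {xs. set xs \<subseteq> index_set l \<and> length xs = k}"
  proof
    fix L assume "L \<in> Pcl l k"
    moreover obtain xs where "L = mset xs"
      by (metis ex_mset)
    ultimately show "L \<in> mset ` {xs. set xs \<subseteq> index_set l \<and> length xs = k}"
      by (auto simp: Pcl_iff)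
  qed
  show "finite (mset ` {xs. set xs \<subseteq> index_set l \<and> length xs = k})"
    by (intro finite_imageI finite_lists_length_eq) simp
qed

text \<open>\<open>ev\<close> skips the index 0, which adds nothing to a sum of indices anyway. This
  turns the congruence on \<open>ev\<close> into one on the additive
  \<open>sum_mset\<close>.\<close>

lemma ev_eq_sum_mset:
  assumes "set_mset L \<subseteq> index_set l"
  shows "ev l L = sum_mset L"
  using assms
proof (induction L)
  case empty
  then show ?case by (simp add: ev_def)
next
  case (add x L)
  have "ev l (add_mset x L) = (\<Sum>i\<in>{1..int l}. i * int (count L i) + (if i = x then i else 0))"
    unfolding ev_def by (intro sum.cong) (auto simp: algebra_simps)
  also have "\<dots> = ev l L + (\<Sum>i\<in>{1..int l}. if i = x then i else 0)"
    by (simp add: ev_def sum.distrib)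
  \<comment> \<open>For \<open>x = 0\<close> no index in the range matches, and the empty
    contribution 0 is still \<open>x\<close>.\<close>
  also have "(\<Sum>i\<in>{1..int l}. if i = x then i else 0) = x"
    using add.prems by (auto simp: index_set_def sum.delta)
  finally show ?case
    using add by simp
qed

lemma Pcl_class_iff:
  assumes "L \<in> Pcl l k"
  shows "L' \<in> Pcl_class l k L \<longleftrightarrow>
    set_mset L' \<subseteq> index_set l \<and> size L' = k \<and> [sum_mset L' = sum_mset L] (mod (int l + 1))"
  using assms by (auto simp: Pcl_class_def Pcl_iff ev_eq_sum_mset)

lemma set_mset_fund_subset [simp]: "set_mset (fund l a) \<subseteq> index_set l"
  using pos_mod_bound[of "int l + 1" a] by (auto simp: fund_def index_set_def)

lemma size_fund [simp]: "size (fund l a) = 1"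
  by (simp add: fund_def)

lemma fund_eq_iff: "fund l a = fund l b \<longleftrightarrow> [a = b] (mod (int l + 1))"
  by (simp add: fund_def cong_def)

lemma fund_index: "a \<in> index_set l \<Longrightarrow> fund l a = {#a#}"
  by (simp add: fund_def index_set_def)

lemma sum_fund_pair_cong:
  assumes "[a + b = c + d] (mod (int l + 1))"
  shows "[sum_mset (fund l a + fund l b + T) = sum_mset (fund l c + fund l d + T)] (mod (int l + 1))"
proof -
  have "[a mod (int l + 1) + b mod (int l + 1) = c mod (int l + 1) + d mod (int l + 1)] (mod (int l + 1))"
    using assms by (simp add: cong_def mod_simps)
  from cong_add[OF this cong_refl[of "sum_mset T"]] show ?thesis
    by (simp add: fund_def add_ac)
qed

lemma fund_pair_eqD:
  assumes "fund l a + fund l b = fund l c + fund l d"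
  shows "fund l a = fund l c \<or> fund l a = fund l d"
  using assms by (auto simp: fund_def add_mset_eq_single add_eq_conv_ex)

text \<open>Needed because \<open>pair_graph\<close> forbids loops. If a move fixed
  \<open>L\<close>, cancelling \<open>T\<close> would make \<open>i - 1\<close> congruent to
  \<open>i\<close>, impossible for a modulus of at least 2, or to \<open>j\<close>, which the side
  condition excludes.\<close>

lemma weight_move_irrefl:
  assumes "l \<ge> 1"
  shows "\<not> weight_move l k L L"
proof
  assume "weight_move l k L L"
  then obtain i j where nc: "\<not> [j = i - 1] (mod (int l + 1))"
    and eq: "fund l (i - 1) + fund l (j + 1) = fund l i + fund l j"
    unfolding weight_move_def by auto
  have "\<not> [i - 1 = i] (mod (int l + 1))"
    using assms by (auto simp: cong_iff_dvd_diff dest: zdvd_imp_le)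
  with fund_pair_eqD[OF eq] nc show False
    by (auto simp: fund_eq_iff cong_sym_eq)
qed

lemma pair_graph_C_graph:
  assumes "l \<ge> 1"
  shows "pair_graph (C_graph l k L)"
proof
  have fin: "finite (Pcl_class l k L)"
    by (rule finite_subset[OF _ finite_Pcl[of l k]]) (auto simp: Pcl_class_def)
  then show "finite (pverts (C_graph l k L))"
    by (simp add: C_graph_def)
  show "finite (parcs (C_graph l k L))"
    by (rule finite_subset[OF _ finite_cartesian_product[OF fin fin]]) (auto simp: C_graph_def)
  show "fst e \<noteq> snd e" if "e \<in> parcs (C_graph l k L)" for e
    using that weight_move_irrefl[OF assms, of k] by (auto simp: C_graph_def)
  show "symmetric (with_proj (C_graph l k L))"
    by (auto simp: symmetric_def C_graph_def intro!: symI)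
qed (auto simp: C_graph_def)

context
  fixes l k :: nat and L :: "int multiset"
  assumes l: "l \<ge> 1" and k: "k \<ge> 2" and L: "L \<in> Pcl l k"
begin

interpretation pair_graph "C_graph l k L"
  using l by (rule pair_graph_C_graph)

lemma pverts_C_graph: "pverts (C_graph l k L) = Pcl_class l k L"
  by (simp add: C_graph_def)

lemma reachable_move:
  assumes v: "fund l a + fund l b + T \<in> Pcl_class l k L"
  shows "(fund l a + fund l b + T) \<rightarrow>\<^sup>*\<^bsub>C_graph l k L\<^esub> (fund l (a - 1) + fund l (b + 1) + T)"
proof (cases "[b = a - 1] (mod (int l + 1))")
  case True
  then have "fund l b = fund l (a - 1)" "fund l (b + 1) = fund l a"
    using cong_add_rcancel[of b 1 "a - 1"] by (simp_all add: fund_eq_iff)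
  then show ?thesis
    using v by (simp add: pverts_C_graph add_ac)
next
  case False
  let ?e = "int l + 1"
  have T: "T \<in> Pcl l (k - 2)"
    using v by (auto simp: Pcl_class_iff[OF L] Pcl_iff)
  \<comment> \<open>The class is preserved because \<open>(a - 1) + (b + 1) = a + b\<close>.\<close>
  have w: "fund l (a - 1) + fund l (b + 1) + T \<in> Pcl_class l k L"
    using v cong_trans[OF sum_fund_pair_cong[of "a - 1" "b + 1" a b l T]]
    by (auto simp: Pcl_class_iff[OF L] dest: subsetD[OF set_mset_fund_subset])
  \<comment> \<open>\<open>a\<close> and \<open>b\<close> are arbitrary integers, so their residues
    serve as the witnesses in \<open>index_set l\<close>.\<close>
  have ij: "a mod ?e \<in> index_set l" "b mod ?e \<in> index_set l"
    using set_mset_fund_subset[of l a] set_mset_fund_subset[of l b] by (simp_all add: fund_def)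
  have "weight_move l k (fund l a + fund l b + T) (fund l (a - 1) + fund l (b + 1) + T)"
    unfolding weight_move_def
    by (rule bexI[OF _ ij(1)], rule bexI[OF _ ij(2)], rule bexI[OF _ T])
       (use False in \<open>simp add: fund_def cong_def mod_simps\<close>)
  with v w show ?thesis
    by (intro reachable_adjI) (simp add: C_graph_def)
qed

text \<open>The arguments of \<open>fund\<close> are unreduced integers, so iterating the move needs
  no separate case when an index wraps around.\<close>

lemma reachable_shift:
  assumes v: "fund l a + fund l b + T \<in> Pcl_class l k L"
  shows "(fund l a + fund l b + T) \<rightarrow>\<^sup>*\<^bsub>C_graph l k L\<^esub>
    (fund l (a - int n) + fund l (b + int n) + T)"
proof (induction n)
  case 0
  then show ?case using v by (simp add: pverts_C_graph)
next
  case (Suc n)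
  then have "fund l (a - int n) + fund l (b + int n) + T \<in> Pcl_class l k L"
    using reachable_in_verts(2) pverts_C_graph by blast
  from reachable_trans[OF Suc.IH reachable_move[OF this]] show ?case
    by (simp add: algebra_simps)
qed

lemma reachable_collect_pair:
  assumes v: "fund l a + fund l b + T \<in> Pcl_class l k L"
  shows "(fund l a + fund l b + T) \<rightarrow>\<^sup>*\<^bsub>C_graph l k L\<^esub> (fund l 0 + fund l (a + b) + T)"
proof -
  \<comment> \<open>The number of moves that lowers \<open>a\<close> to 0 modulo
    \<open>l + 1\<close>.\<close>
  let ?n = "nat (a mod (int l + 1))"
  have "fund l (a - int ?n) = fund l 0" "fund l (b + int ?n) = fund l (a + b)"
    by (simp_all add: fund_def mod_simps add.commute)
  with reachable_shift[OF v, of ?n] show ?thesis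
    by simp
qed

text \<open>\<open>a\<close> acts as an accumulator: each \<open>x\<close> taken from
  \<open>N\<close> is absorbed into it and leaves behind a 0, which is parked in \<open>U\<close>.
  Hence the induction generalises over both \<open>a\<close> and \<open>U\<close>.\<close>

lemma reachable_collect:
  assumes "fund l a + N + U \<in> Pcl_class l k L"
  shows "(fund l a + N + U) \<rightarrow>\<^sup>*\<^bsub>C_graph l k L\<^esub>
    (fund l (a + sum_mset N) + replicate_mset (size N) 0 + U)"
  using assms
proof (induction N arbitrary: a U)
  case empty
  then show ?case by (simp add: pverts_C_graph)
next
  case (add x N)
  then have "x \<in> index_set l"
    by (auto simp: Pcl_class_iff[OF L])
  then have start: "fund l a + add_mset x N + U = fund l a + fund l x + (N + U)"
    by (simp add: fund_index)
  have collected: "fund l 0 + fund l (a + x) + (N + U) = fund l (a + x) + N + add_mset 0 U"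
    by (simp add: fund_def)
  have step: "(fund l a + add_mset x N + U) \<rightarrow>\<^sup>*\<^bsub>C_graph l k L\<^esub>
    (fund l (a + x) + N + add_mset 0 U)"
    using reachable_collect_pair[of a x "N + U"] add.prems unfolding start collected by blast
  then have "fund l (a + x) + N + add_mset 0 U \<in> Pcl_class l k L"
    using reachable_in_verts(2) pverts_C_graph by blast
  from reachable_trans[OF step add.IH[OF this]] show ?case
    by (simp add: add_ac)
qed

lemma reachable_canonical:
  assumes v: "M \<in> Pcl_class l k L"
  shows "M \<rightarrow>\<^sup>*\<^bsub>C_graph l k L\<^esub> (fund l (sum_mset L) + replicate_mset (k - 1) 0)"
proof -
  have M: "set_mset M \<subseteq> index_set l" "size M = k" "[sum_mset M = sum_mset L] (mod (int l + 1))"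
    using v by (simp_all add: Pcl_class_iff[OF L])
  then obtain a N where MN: "M = add_mset a N"
    using k by (cases M) auto
  then have "M = fund l a + N + {#}"
    using M by (simp add: fund_index)
  \<comment> \<open>Only the residue of \<open>sum_mset M\<close> matters here, and membership in
    the class makes it that of \<open>sum_mset L\<close>. The endpoint is therefore the same for
    every \<open>M\<close>.\<close>
  moreover have "fund l (a + sum_mset N) = fund l (sum_mset L)" "size N = k - 1"
    using M MN by (auto simp: fund_eq_iff)
  ultimately show ?thesis
    using reachable_collect[of a N "{#}"] v by simp
qed

text \<open>Go from \<open>M\<close> to the canonical weight, then follow the path from
  \<open>N\<close> backwards, as the arcs are symmetric.\<close>

lemma reachable_C_graph:
  assumes "M \<in> Pcl_class l k L" "N \<in> Pcl_class l k L"
  shows "M \<rightarrow>\<^sup>*\<^bsub>C_graph l k L\<^esub> N"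
  using assms by (meson reachable_canonical reachable_trans symmetric_reachable')

lemma self_in_Pcl_class: "L \<in> Pcl_class l k L"
  using L by (simp add: Pcl_class_def)

lemma apath_C_graph: "M \<in> Pcl_class l k L \<Longrightarrow> \<exists>p. apath L p M"
  using reachable_C_graph[OF self_in_Pcl_class] by (simp add: reachable_apath)

lemma connected_C_graph: "Digraph_Component.connected (with_proj (C_graph l k L))"
  \<comment> \<open>Connectedness means strong connectedness of the symmetric closure and includes
    having a vertex, which \<open>L\<close> provides.\<close>
  using self_in_Pcl_class reachable_C_graph
  by (intro connectedI) (auto simp: pverts_C_graph intro!: reachable_mk_symmetricI)

end

theorem lemma3p10:
  fixes l k :: nat and \<Lambda> :: "int multiset"
  assumes "l \<ge> 1" and "k \<ge> 2" and "\<Lambda> \<in> Pcl l k"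
  shows "(\<forall>\<Lambda>' \<in> Pcl_class l k \<Lambda>. \<exists>p. pre_digraph.apath (with_proj (C_graph l k \<Lambda>)) \<Lambda> p \<Lambda>')
       \<and> pair_graph (C_graph l k \<Lambda>)
       \<and> Digraph_Component.connected (with_proj (C_graph l k \<Lambda>))"
  using apath_C_graph[OF assms] pair_graph_C_graph[OF assms(1)] connected_C_graph[OF assms]
  by blast

end
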